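(* There is a constant $B$ such that for every sequence $(c_n)_{n\ge 0}$ in $X$ and all sequences $(a_n)_{n\ge 0}, (b_n)_{n\ge 0}$ in $\ell^2_+$, $$\sum_{n,m=0}^{\infty} |a_n|\,|b_m|\,|c_{n+m}| \le B\, \|(c_n)\|\, \|(a_n)\|_2\, \|(b_n)\|_2 .$$
   Context: $X$ denotes the space of (complex) sequences $(c_n)_{n\ge 0}$ such that $$\|(c_n)\|^2 = \sup\left\{ \frac{\sum_{k=0}^n (k+1)^2 |c_k|^2}{n+1} : n\in\mathbb{N}\right\} < \infty ,$$ and $\|(c_n)\|$ is the norm on $X$ so defined. $\ell^2_+$ is the Hilbert space of square-summable complex sequences indexed by the integers $n\ge 0$, with norm $\|(a_n)\|_2=\left(\sum_{n\ge 0}|a_n|^2\right)^{1/2}$. *)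

theory Defs
  imports "HOL-Analysis.Analysis"
begin

definition X_mean :: "(nat \<Rightarrow> complex) \<Rightarrow> nat \<Rightarrow> real" where
  "X_mean c n = (\<Sum>k\<le>n. (real k + 1)\<^sup>2 * (cmod (c k))\<^sup>2) / (real n + 1)"

text \<open>
  The real-valued supremum is only meaningful for bounded families, so finiteness of the norm
  is stated as boundedness, and \<open>X_norm\<close> is to be used on \<open>X_space\<close> only.
\<close>

definition X_space :: "(nat \<Rightarrow> complex) set" where
  "X_space = {c. bdd_above (range (X_mean c))}"

definition X_norm :: "(nat \<Rightarrow> complex) \<Rightarrow> real" where
  "X_norm c = sqrt (SUP n. X_mean c n)"

definition ell2 :: "(nat \<Rightarrow> complex) set" where
  "ell2 = {a. summable (\<lambda>n. (cmod (a n))\<^sup>2)}"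

definition ell2_norm :: "(nat \<Rightarrow> complex) \<Rightarrow> real" where
  "ell2_norm a = sqrt (\<Sum>n. (cmod (a n))\<^sup>2)"

end

theory Submission
  imports Defs
begin

text \<open>
  By symmetry it is enough to bound the part \<open>m \<le> n\<close> of the double sum. There the Cauchy--Schwarz
  inequality is applied to \<open>x\<^sub>n y\<^sub>m g\<^sub>n\<^sub>+\<^sub>m\<close>, factored as \<open>x\<^sub>n / \<theta>\<close> times
  \<open>\<theta> y\<^sub>m g\<^sub>n\<^sub>+\<^sub>m\<close> with \<open>\<theta> = ((m+1)(n+1))\<^sup>1\<^sup>/\<^sup>4\<close>; this is
  a Schur test. The squares of the first factor sum to at most
  \<open>2 \<Sum> x\<^sub>n\<^sup>2\<close>, because \<open>\<Sum>m\<le>n. (m+1)\<^sup>-\<^sup>1\<^sup>/\<^sup>2\<close> is at most \<open>2 (n+1)\<^sup>1\<^sup>/\<^sup>2\<close>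
  (lemma \<open>sum_inverse_sqrt_le\<close>).

  The squares of the second factor sum to at most \<open>3 N \<Sum> y\<^sub>m\<^sup>2\<close>, where \<open>N\<close> bounds the averages of
  \<open>(k+1)\<^sup>2 g\<^sub>k\<^sup>2\<close>. This is where membership in the space \<open>X\<close> enters: averages of \<open>(k+1)\<^sup>2 g\<^sub>k\<^sup>2\<close>
  that stay below \<open>N\<close> may be replaced, when tested against a decreasing weight, by the constant
  \<open>N\<close>, the allowance \<open>N (m+1)\<close> of the indices up to the starting point \<open>m\<close> being spent at \<open>m\<close>
  (lemma \<open>sum_weighted_le_of_mean_le\<close>, a summation by parts). With the weight
  \<open>(k+1)\<^sup>-\<^sup>3\<^sup>/\<^sup>2\<close> this gives a bound \<open>3 N (m+1)\<^sup>-\<^sup>1\<^sup>/\<^sup>2\<close> for the tail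
  \<open>\<Sum>k\<ge>m. (k+1)\<^sup>1\<^sup>/\<^sup>2 g\<^sub>k\<^sup>2\<close> (lemma \<open>sqrt_weighted_tail_le\<close>), which cancels the weight
  \<open>(m+1)\<^sup>1\<^sup>/\<^sup>2\<close> exactly.

  All estimates are made for finite sums, with constants that do not depend on the truncation, so
  that summability of the nonnegative double series comes out together with the bound.
\<close>

lemma sum_inverse_sqrt_le: "(\<Sum>m\<le>n. 1 / sqrt (real m + 1)) \<le> 2 * sqrt (real n + 1)"
proof (induction n)
  case 0
  show ?case by simp
next
  case (Suc n)
  define u v where "u = sqrt (real n + 1)" and "v = sqrt (real n + 2)"
  have v: "v > 0" and sq: "u\<^sup>2 = real n + 1" "v\<^sup>2 = real n + 2"
    by (auto simp: u_def v_def)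
  \<comment> \<open>Since \<open>v\<^sup>2 - u\<^sup>2 = 1\<close>, the square \<open>(v - u)\<^sup>2\<close> equals \<open>2 (v - u) v - 1\<close>.\<close>
  have "0 \<le> (v - u)\<^sup>2" by simp
  then have "1 \<le> 2 * (v - u) * v"
    using sq by (simp add: power2_eq_square algebra_simps)
  then have "1 / v \<le> 2 * v - 2 * u"
    using v by (simp add: field_simps)
  then show ?case
    using Suc.IH by (simp add: u_def v_def add.commute)
qed

text \<open>
  Summation by parts in the form of an induction: \<open>N (M+1) - \<Sum>k\<le>M. s k\<close> is the mass that the
  mean condition still leaves unspent, and since \<open>w\<close> decreases, this mass is worth less and less.
  Adding its current value to the left-hand side makes the estimate inductive.
\<close>

lemma sum_weighted_le_of_mean_le:
  fixes s w :: "nat \<Rightarrow> real"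
  assumes s: "\<And>k. 0 \<le> s k" and mean: "\<And>n. (\<Sum>k\<le>n. s k) \<le> N * (real n + 1)"
    and w: "\<And>k. 0 \<le> w k" and dec: "\<And>k. w (Suc k) \<le> w k"
    and "m \<le> M"
  shows "(\<Sum>k=m..M. s k * w k) \<le> N * ((real m + 1) * w m + (\<Sum>k=Suc m..M. w k))"
proof -
  have "(\<Sum>k=m..M. s k * w k) + (N * (real M + 1) - (\<Sum>k\<le>M. s k)) * w M
      \<le> N * ((real m + 1) * w m + (\<Sum>k=Suc m..M. w k))"
    using \<open>m \<le> M\<close>
  proof (induction M rule: dec_induct)
    case base
    have "s m \<le> (\<Sum>k\<le>m. s k)"
      by (rule member_le_sum) (auto simp: s)
    then have "s m * w m \<le> (\<Sum>k\<le>m. s k) * w m"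
      by (rule mult_right_mono) (rule w)
    then show ?case by (simp add: algebra_simps)
  next
    case (step M)
    have "(N * (real M + 1) - (\<Sum>k\<le>M. s k)) * w (Suc M)
        \<le> (N * (real M + 1) - (\<Sum>k\<le>M. s k)) * w M"
      using mean[of M] dec by (intro mult_left_mono) auto
    then show ?case
      using step by (simp add: algebra_simps)
  qed
  moreover have "0 \<le> (N * (real M + 1) - (\<Sum>k\<le>M. s k)) * w M"
    using mean[of M] w by (intro mult_nonneg_nonneg) auto
  ultimately show ?thesis by linarith
qed

text \<open>
  The discrete counterpart of \<open>\<integral> t\<^sup>-\<^sup>3\<^sup>/\<^sup>2 dt = - 2 t\<^sup>-\<^sup>1\<^sup>/\<^sup>2\<close>: each summand is at most the
  increment of \<open>- 2 t\<^sup>-\<^sup>1\<^sup>/\<^sup>2\<close> over the unit interval that ends there.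
\<close>

lemma sum_powr_three_halves_tail_le:
  assumes "m \<le> M"
  shows "(\<Sum>k=Suc m..M. 1 / ((real k + 1) * sqrt (real k + 1)))
    \<le> 2 / sqrt (real m + 1) - 2 / sqrt (real M + 1)"
  using assms
proof (induction M rule: dec_induct)
  case base
  show ?case by simp
next
  case (step M)
  define u v where "u = sqrt (real M + 1)" and "v = sqrt (real M + 2)"
  have u: "u > 0" and v: "v > 0" and uv: "u \<le> v" and sq: "u\<^sup>2 = real M + 1" "v\<^sup>2 = real M + 2"
    by (auto simp: u_def v_def)
  have "(v - u) * (v + u) = 1"
    using sq by (simp add: power2_eq_square algebra_simps)
  moreover have "(v - u) * (v + u) \<le> (v - u) * (2 * v)"
    using uv by (intro mult_left_mono) auto
  ultimately have "1 * u \<le> ((v - u) * (2 * v)) * v"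
    using u v uv by (intro mult_mono) auto
  then have "1 / (v\<^sup>2 * v) \<le> 2 / u - 2 / v"
    using u v by (simp add: field_simps power2_eq_square)
  then show ?case
    using step by (simp add: u_def v_def add.commute)
qed

lemma sqrt_weighted_tail_le:
  fixes g :: "nat \<Rightarrow> real"
  assumes mean: "\<And>n. (\<Sum>k\<le>n. (real k + 1)\<^sup>2 * (g k)\<^sup>2) \<le> N * (real n + 1)"
    and "m \<le> M"
  shows "(\<Sum>k=m..M. sqrt (real k + 1) * (g k)\<^sup>2) \<le> 3 * N / sqrt (real m + 1)"
proof -
  define w where "w k = 1 / ((real k + 1) * sqrt (real k + 1))" for k
  have N: "0 \<le> N"
    using mean[of 0] by (simp add: order_trans[OF zero_le_power2])
  have weight: "sqrt (real k + 1) * (g k)\<^sup>2 = ((real k + 1)\<^sup>2 * (g k)\<^sup>2) * w k" for k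
  proof -
    define t where "t = sqrt (real k + 1)"
    have "t > 0" and "real k + 1 = t\<^sup>2"
      by (auto simp: t_def)
    then show ?thesis
      by (simp add: w_def power2_eq_square)
  qed
  have "(\<Sum>k=m..M. sqrt (real k + 1) * (g k)\<^sup>2)
      \<le> N * ((real m + 1) * w m + (\<Sum>k=Suc m..M. w k))"
    unfolding weight
  proof (rule sum_weighted_le_of_mean_le)
    show "w (Suc k) \<le> w k" for k
      unfolding w_def by (intro divide_left_mono mult_mono mult_pos_pos) auto
  qed (use mean \<open>m \<le> M\<close> in \<open>auto simp: w_def\<close>)
  also have "\<dots> \<le> N * (1 / sqrt (real m + 1) + 2 / sqrt (real m + 1))"
  proof (intro mult_left_mono add_mono N)
    have "0 \<le> 2 / sqrt (real M + 1)" by simp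
    then show "(\<Sum>k=Suc m..M. w k) \<le> 2 / sqrt (real m + 1)"
      using sum_powr_three_halves_tail_le[OF \<open>m \<le> M\<close>] unfolding w_def by linarith
  qed (simp add: w_def)
  finally show ?thesis by (simp add: field_simps)
qed

lemma lower_triangle_sum_le:
  fixes x y g :: "nat \<Rightarrow> real"
  assumes mean: "\<And>n. (\<Sum>k\<le>n. (real k + 1)\<^sup>2 * (g k)\<^sup>2) \<le> N * (real n + 1)"
    and x: "\<And>n. (\<Sum>k\<le>n. (x k)\<^sup>2) \<le> P"
    and y: "\<And>n. (\<Sum>k\<le>n. (y k)\<^sup>2) \<le> Q"
  shows "(\<Sum>n\<le>K. \<Sum>m\<le>n. x n * y m * g (n + m)) \<le> sqrt (6 * N * P * Q)"
proof -
  define r where "r n = sqrt (real n + 1)" for n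
  have r: "r n > 0" for n by (simp add: r_def)
  define T where "T = (SIGMA n:{..K}. {..n})"
  define F where "F = (\<lambda>(n, m). x n / sqrt (r m * r n))"
  define G where "G = (\<lambda>(n, m). y m * sqrt (r m * r n) * g (n + m))"
  have T_sum: "(\<Sum>p\<in>T. h p) = (\<Sum>n\<le>K. \<Sum>m\<le>n. h (n, m))" for h :: "nat \<times> nat \<Rightarrow> real"
    by (simp add: T_def sum.Sigma)
  have N: "0 \<le> N"
    using mean[of 0] by (simp add: order_trans[OF zero_le_power2])
  have P: "0 \<le> P"
    using x[of 0] by (simp add: order_trans[OF zero_le_power2])

  have "(\<Sum>p\<in>T. (F p)\<^sup>2) = (\<Sum>n\<le>K. (x n)\<^sup>2 / r n * (\<Sum>m\<le>n. 1 / r m))"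
    using r by (simp add: T_sum F_def power_divide less_imp_le sum_distrib_left
        sum_divide_distrib mult.commute)
  also have "\<dots> \<le> (\<Sum>n\<le>K. (x n)\<^sup>2 / r n * (2 * r n))"
    using r sum_inverse_sqrt_le
    by (intro sum_mono mult_left_mono) (auto simp: r_def)
  also have "\<dots> = 2 * (\<Sum>n\<le>K. (x n)\<^sup>2)"
    using r by (simp add: sum_distrib_left less_imp_neq[THEN not_sym] mult.commute)
  also have "\<dots> \<le> 2 * P"
    using x by simp
  finally have F: "(\<Sum>p\<in>T. (F p)\<^sup>2) \<le> 2 * P" .

  \<comment> \<open>Replacing \<open>(n+1)\<^sup>1\<^sup>/\<^sup>2\<close> by the larger \<open>(n+m+1)\<^sup>1\<^sup>/\<^sup>2\<close> turns the inner sum into a piece, starting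
      at \<open>2 m \<ge> m\<close>, of the tail of a weighted sum in the single index \<open>n + m\<close>.\<close>
  have inner: "(\<Sum>n=m..K. r n * (g (n + m))\<^sup>2) \<le> 3 * N / r m" if "m \<le> K" for m
  proof -
    have "(\<Sum>n=m..K. r n * (g (n + m))\<^sup>2) \<le> (\<Sum>n=m..K. r (n + m) * (g (n + m))\<^sup>2)"
      by (intro sum_mono mult_right_mono) (auto simp: r_def)
    also have "\<dots> = (\<Sum>k=m+m..K+m. r k * (g k)\<^sup>2)"
      by (rule sum.shift_bounds_cl_nat_ivl[symmetric])
    also have "\<dots> \<le> (\<Sum>k=m..K+m. r k * (g k)\<^sup>2)"
      using r by (intro sum_mono2) (auto simp: less_imp_le)
    also have "\<dots> \<le> 3 * N / r m"
      using sqrt_weighted_tail_le[OF mean, of m "K + m"] by (simp add: r_def)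
    finally show ?thesis .
  qed
  have "(\<Sum>p\<in>T. (G p)\<^sup>2) = (\<Sum>n\<le>K. \<Sum>m\<in>{m\<in>{..K}. m \<le> n}. (y m)\<^sup>2 * r m * (r n * (g (n + m))\<^sup>2))"
    using r by (auto simp: T_sum G_def power_mult_distrib less_imp_le
        mult.assoc intro!: sum.cong)
  also have "\<dots> = (\<Sum>m\<le>K. \<Sum>n\<in>{n\<in>{..K}. m \<le> n}. (y m)\<^sup>2 * r m * (r n * (g (n + m))\<^sup>2))"
    by (rule sum.swap_restrict) auto
  also have "\<dots> = (\<Sum>m\<le>K. (y m)\<^sup>2 * r m * (\<Sum>n=m..K. r n * (g (n + m))\<^sup>2))"
    by (auto simp: sum_distrib_left intro!: sum.cong)
  also have "\<dots> \<le> (\<Sum>m\<le>K. (y m)\<^sup>2 * r m * (3 * N / r m))"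
    using r by (intro sum_mono mult_left_mono inner) (auto simp: less_imp_le)
  also have "\<dots> = 3 * N * (\<Sum>m\<le>K. (y m)\<^sup>2)"
    using r by (simp add: sum_distrib_left less_imp_neq[THEN not_sym] ac_simps)
  also have "\<dots> \<le> 3 * N * Q"
    using y N by (intro mult_left_mono) auto
  finally have G: "(\<Sum>p\<in>T. (G p)\<^sup>2) \<le> 3 * N * Q" .

  have "(\<Sum>n\<le>K. \<Sum>m\<le>n. x n * y m * g (n + m)) = (\<Sum>p\<in>T. F p * G p)"
    using r by (simp add: T_sum F_def G_def less_imp_neq[THEN not_sym] mult.assoc)
  also have "\<dots> \<le> sqrt ((\<Sum>p\<in>T. (F p)\<^sup>2) * (\<Sum>p\<in>T. (G p)\<^sup>2))"
    by (rule real_le_rsqrt[OF Cauchy_Schwarz_ineq_sum])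
  also have "\<dots> \<le> sqrt ((2 * P) * (3 * N * Q))"
    using F G P by (intro real_sqrt_le_mono mult_mono) (auto intro: sum_nonneg)
  finally show ?thesis by (simp add: mult.assoc mult.left_commute)
qed

lemma square_sum_le_triangle_sums:
  fixes f :: "nat \<Rightarrow> nat \<Rightarrow> real"
  assumes "\<And>n m. 0 \<le> f n m"
  shows "(\<Sum>n\<le>K. \<Sum>m\<le>K. f n m) \<le> (\<Sum>n\<le>K. \<Sum>m\<le>n. f n m) + (\<Sum>m\<le>K. \<Sum>n\<le>m. f n m)"
proof (induction K)
  case 0
  show ?case using assms by simp
next
  case (Suc K)
  have "0 \<le> f (Suc K) (Suc K)" by (rule assms)
  then show ?case
    using Suc.IH by (simp add: sum.distrib)
qed

lemma square_sum_le:
  fixes x y g :: "nat \<Rightarrow> real"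
  assumes nonneg: "\<And>n. 0 \<le> x n" "\<And>n. 0 \<le> y n" "\<And>n. 0 \<le> g n"
    and mean: "\<And>n. (\<Sum>k\<le>n. (real k + 1)\<^sup>2 * (g k)\<^sup>2) \<le> N * (real n + 1)"
    and x: "\<And>n. (\<Sum>k\<le>n. (x k)\<^sup>2) \<le> P"
    and y: "\<And>n. (\<Sum>k\<le>n. (y k)\<^sup>2) \<le> Q"
  shows "(\<Sum>n\<le>K. \<Sum>m\<le>K. x n * y m * g (n + m)) \<le> 2 * sqrt 6 * sqrt N * sqrt P * sqrt Q"
proof -
  have "(\<Sum>n\<le>K. \<Sum>m\<le>K. x n * y m * g (n + m))
      \<le> (\<Sum>n\<le>K. \<Sum>m\<le>n. x n * y m * g (n + m)) + (\<Sum>m\<le>K. \<Sum>n\<le>m. x n * y m * g (n + m))"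
    using nonneg by (intro square_sum_le_triangle_sums) simp
  also have "\<dots> \<le> sqrt (6 * N * P * Q) + sqrt (6 * N * Q * P)"
    using lower_triangle_sum_le[OF mean x y, of K] lower_triangle_sum_le[OF mean y x, of K]
    by (simp add: ac_simps)
  finally show ?thesis
    by (simp add: real_sqrt_mult ac_simps)
qed

lemma sum_cmod_squares_le:
  assumes "a \<in> ell2"
  shows "(\<Sum>k\<le>n. (cmod (a k))\<^sup>2) \<le> (\<Sum>k. (cmod (a k))\<^sup>2)"
  using assms by (intro sum_le_suminf) (auto simp: ell2_def)

lemma X_space_sum_le:
  assumes "c \<in> X_space"
  shows "(\<Sum>k\<le>n. (real k + 1)\<^sup>2 * (cmod (c k))\<^sup>2) \<le> (SUP n. X_mean c n) * (real n + 1)"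
proof -
  have "X_mean c n \<le> (SUP n. X_mean c n)"
    using assms by (intro cSUP_upper) (auto simp: X_space_def)
  then show ?thesis
    by (simp add: X_mean_def pos_divide_le_eq)
qed

theorem theorem3p3:
  shows "\<exists>B::real. \<forall>c\<in>X_space. \<forall>a\<in>ell2. \<forall>b\<in>ell2.
    (\<lambda>(n, m). cmod (a n) * cmod (b m) * cmod (c (n + m))) summable_on (UNIV \<times> UNIV) \<and>
    (\<Sum>\<^sub>\<infinity>(n, m)\<in>UNIV \<times> UNIV. cmod (a n) * cmod (b m) * cmod (c (n + m)))
      \<le> B * X_norm c * ell2_norm a * ell2_norm b"
proof (intro exI ballI)
  fix c a b
  assume c: "c \<in> X_space" and a: "a \<in> ell2" and b: "b \<in> ell2"
  define f where "f = (\<lambda>(n, m). cmod (a n) * cmod (b m) * cmod (c (n + m)))"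
  define C where "C = 2 * sqrt 6 * X_norm c * ell2_norm a * ell2_norm b"
  have f_nonneg: "0 \<le> f p" for p
    by (simp add: f_def split: prod.split)
  have finite_le: "sum f S \<le> C" if "finite S" for S
  proof -
    have "finite (fst ` S \<union> snd ` S)"
      using that by simp
    then obtain K where "fst ` S \<union> snd ` S \<subseteq> {..K}"
      by (auto simp: finite_nat_iff_bounded_le)
    then have K: "S \<subseteq> {..K} \<times> {..K}"
      by force
    have "sum f S \<le> sum f ({..K} \<times> {..K})"
      using K f_nonneg by (intro sum_mono2) auto
    also have "\<dots> = (\<Sum>n\<le>K. \<Sum>m\<le>K. cmod (a n) * cmod (b m) * cmod (c (n + m)))"
      by (simp add: f_def sum.cartesian_product)
    also have "\<dots> \<le> C"
      unfolding C_def X_norm_def ell2_norm_def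
      using X_space_sum_le[OF c] sum_cmod_squares_le[OF a] sum_cmod_squares_le[OF b]
      by (intro square_sum_le) auto
    finally show ?thesis .
  qed
  have "f summable_on (UNIV \<times> UNIV)"
    using f_nonneg finite_le by (intro nonneg_bdd_above_summable_on bdd_aboveI2[of _ _ C]) auto
  moreover from this have "infsum f (UNIV \<times> UNIV) \<le> C"
    by (rule infsum_le_finite_sums) (rule finite_le)
  ultimately show "(\<lambda>(n, m). cmod (a n) * cmod (b m) * cmod (c (n + m))) summable_on (UNIV \<times> UNIV) \<and>
    (\<Sum>\<^sub>\<infinity>(n, m)\<in>UNIV \<times> UNIV. cmod (a n) * cmod (b m) * cmod (c (n + m)))
      \<le> 2 * sqrt 6 * X_norm c * ell2_norm a * ell2_norm b"
    unfolding f_def C_def by blast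
qed

end
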